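(* Let $n\ge1$ be an integer with $\gcd(n,6)=2$, and let $G=G_n(x_0x_1x_{n/2-1})$. Then $$G^{\mathrm{ab}}\cong\begin{cases} \mathbb{Z}_{3L_{n/2}} & \text{if }\gcd(n,16)=2,\\ \mathbb{Z}_{F_{n/4}}\oplus\mathbb{Z}_{15F_{n/4}} & \text{if }\gcd(n,16)=4,\\ \mathbb{Z}_3\oplus\mathbb{Z}_{L_{n/4}}\oplus\mathbb{Z}_{L_{n/4}} & \text{if }\gcd(n,16)=8,\\ \mathbb{Z}_{L_{n/4}}\oplus\mathbb{Z}_{3L_{n/4}} & \text{if }\gcd(n,16)=16. \end{cases}$$
   Context: For an element $w=w(x_0,\dots,x_{n-1})$ of the free group on $x_0,\dots,x_{n-1}$, the cyclically presented group $G_n(w)$ is the group with presentation $\langle x_0,\dots,x_{n-1}\mid w(x_i,x_{i+1},\dots,x_{i+n-1})\ (0\le i<n)\rangle$, subscripts taken mod $n$. $G^{\mathrm{ab}}$ denotes the abelianization of $G$, and $\mathbb{Z}_m=\mathbb{Z}/m\mathbb{Z}$ (so $\mathbb{Z}_1$ is trivial). $F_j$ are the Fibonacci numbers ($F_0=0$, $F_1=1$, $F_j=F_{j-1}+F_{j-2}$ for $j\ge2$) and $L_j$ the Lucas numbers ($L_0=2$, $L_1=1$, $L_j=L_{j-1}+L_{j-2}$ for $j\ge 2$). *)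

theory Defs
  imports "HOL-Algebra.Elementary_Groups" "HOL-Algebra.Generated_Groups" "HOL-Number_Theory.Fib"
begin

section \<open>Free groups\<close>

text \<open>
  A word is a list of letters: \<open>(x, True)\<close> stands for the generator \<open>x\<close>
  and \<open>(x, False)\<close> for its inverse.
\<close>

type_synonym 'a gword = "('a \<times> bool) list"

inductive free_eq :: "'a gword \<Rightarrow> 'a gword \<Rightarrow> bool" where
  refl: "free_eq u u"
| sym: "free_eq u v \<Longrightarrow> free_eq v u"
| trans: "free_eq u v \<Longrightarrow> free_eq v w \<Longrightarrow> free_eq u w"
| cancel: "free_eq (u @ [(x, b), (x, \<not> b)] @ v) (u @ v)"

definition gwords :: "'a set \<Rightarrow> 'a gword set" where
  "gwords X = lists (X \<times> UNIV)"

definition free_rel :: "'a set \<Rightarrow> ('a gword \<times> 'a gword) set" where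
  "free_rel X = {(u, v). u \<in> gwords X \<and> v \<in> gwords X \<and> free_eq u v}"

definition free_class :: "'a set \<Rightarrow> 'a gword \<Rightarrow> 'a gword set" where
  "free_class X u = free_rel X `` {u}"

definition free_group :: "'a set \<Rightarrow> 'a gword set monoid" where
  "free_group X =
     \<lparr>carrier = gwords X // free_rel X,
      mult = (\<lambda>A B. \<Union>u\<in>A. \<Union>v\<in>B. free_class X (u @ v)),
      one = free_class X []\<rparr>"

definition free_gen :: "'a set \<Rightarrow> 'a \<Rightarrow> 'a gword set" where
  "free_gen X x = free_class X [(x, True)]"

text \<open>
  For \<open>f\<close> mapping \<open>X\<close> into \<open>Y\<close>, the homomorphism from the free group on \<open>X\<close> to the
  free group on \<open>Y\<close> induced by \<open>f\<close>, i.e. the substitution of \<open>f x\<close> for each generator \<open>x\<close>.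
\<close>

definition free_subst :: "'b set \<Rightarrow> ('a \<Rightarrow> 'b) \<Rightarrow> 'a gword set \<Rightarrow> 'b gword set" where
  "free_subst Y f A = (\<Union>u\<in>A. free_class Y (map (apfst f) u))"


section \<open>Presentations, cyclically presented groups and abelianization\<close>

definition normal_closure :: "('a, 'b) monoid_scheme \<Rightarrow> 'a set \<Rightarrow> 'a set" where
  "normal_closure G S = \<Inter>{N. N \<lhd> G \<and> S \<subseteq> N}"

definition presented_group :: "'a set \<Rightarrow> 'a gword set set \<Rightarrow> 'a gword set set monoid" where
  "presented_group X R = free_group X Mod normal_closure (free_group X) R"

definition cyc_presented_group :: "nat \<Rightarrow> nat gword set \<Rightarrow> nat gword set set monoid" where
  "cyc_presented_group n w =
     presented_group {..<n} ((\<lambda>i. free_subst {..<n} (\<lambda>j. (i + j) mod n) w) ` {..<n})"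

definition abelianization :: "('a, 'b) monoid_scheme \<Rightarrow> 'a set monoid" where
  "abelianization G = G Mod derived G (carrier G)"


section \<open>Lucas numbers\<close>

fun lucas :: "nat \<Rightarrow> nat" where
  "lucas 0 = 2"
| "lucas (Suc 0) = 1"
| "lucas (Suc (Suc n)) = lucas (Suc n) + lucas n"


section \<open>Basic properties\<close>

lemma free_eq_append_left: "free_eq u v \<Longrightarrow> free_eq (p @ u) (p @ v)"
proof (induction rule: free_eq.induct)
  case (cancel u x b v)
  show ?case using free_eq.cancel[of "p @ u" x b v] by simp
qed (blast intro: free_eq.intros(1-3))+

lemma free_eq_append_right: "free_eq u v \<Longrightarrow> free_eq (u @ q) (v @ q)"
proof (induction rule: free_eq.induct)
  case (cancel u x b v)
  show ?case using free_eq.cancel[of u x b "v @ q"] by simp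
qed (blast intro: free_eq.intros(1-3))+

lemma free_eq_append: "free_eq u u' \<Longrightarrow> free_eq v v' \<Longrightarrow> free_eq (u @ v) (u' @ v')"
  by (meson free_eq.trans free_eq_append_left free_eq_append_right)

lemma free_eq_map: "free_eq u v \<Longrightarrow> free_eq (map (apfst f) u) (map (apfst f) v)"
proof (induction rule: free_eq.induct)
  case (cancel u x b v)
  show ?case
    using free_eq.cancel[of "map (apfst f) u" "f x" b "map (apfst f) v"] by simp
qed (blast intro: free_eq.intros(1-3))+

lemma gwords_Nil [simp]: "[] \<in> gwords X"
  and gwords_append [simp]: "u @ v \<in> gwords X \<longleftrightarrow> u \<in> gwords X \<and> v \<in> gwords X"
  and gwords_Cons [simp]: "(x, b) # u \<in> gwords X \<longleftrightarrow> x \<in> X \<and> u \<in> gwords X"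
  by (auto simp: gwords_def)

lemma gwords_map: "u \<in> gwords X \<Longrightarrow> f ` X \<subseteq> Y \<Longrightarrow> map (apfst f) u \<in> gwords Y"
  unfolding gwords_def by (induction u) (auto simp: image_subset_iff)

lemma equiv_free_rel: "equiv (gwords X) (free_rel X)"
  by (rule equivI) (auto simp: free_rel_def refl_on_def sym_def trans_def
      intro: free_eq.refl free_eq.sym elim: free_eq.trans)

lemma mem_free_class: "u \<in> gwords X \<Longrightarrow> v \<in> free_class X u \<longleftrightarrow> v \<in> gwords X \<and> free_eq u v"
  by (auto simp: free_class_def free_rel_def)

lemma free_class_eq_iff:
  "u \<in> gwords X \<Longrightarrow> v \<in> gwords X \<Longrightarrow> free_class X u = free_class X v \<longleftrightarrow> free_eq u v"
  unfolding free_class_def using eq_equiv_class_iff[OF equiv_free_rel, of u X v]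
  by (simp add: free_rel_def)

lemma carrier_free_group: "carrier (free_group X) = free_class X ` gwords X"
  by (auto simp: free_group_def quotient_def free_class_def)

lemma one_free_group: "\<one>\<^bsub>free_group X\<^esub> = free_class X []"
  by (simp add: free_group_def)

lemma mult_free_class:
  assumes "u \<in> gwords X" "v \<in> gwords X"
  shows "free_class X u \<otimes>\<^bsub>free_group X\<^esub> free_class X v = free_class X (u @ v)"
proof -
  have "free_class X (u' @ v') = free_class X (u @ v)"
    if "u' \<in> free_class X u" "v' \<in> free_class X v" for u' v'
    using that assms free_eq.sym[OF free_eq_append]
    by (auto simp: mem_free_class free_class_eq_iff)
  moreover have "u \<in> free_class X u" "v \<in> free_class X v"
    using assms by (auto simp: mem_free_class intro: free_eq.refl)
  ultimately have "(\<Union>u'\<in>free_class X u. \<Union>v'\<in>free_class X v. free_class X (u' @ v')) = free_class X (u @ v)"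
    by blast
  then show ?thesis by (simp add: free_group_def)
qed

lemma free_subst_class:
  assumes "u \<in> gwords X" "f ` X \<subseteq> Y"
  shows "free_subst Y f (free_class X u) = free_class Y (map (apfst f) u)"
proof -
  have "free_class Y (map (apfst f) u') = free_class Y (map (apfst f) u)"
    if "u' \<in> free_class X u" for u'
    using that assms gwords_map[OF _ assms(2)]
    by (metis free_class_eq_iff free_eq.sym free_eq_map mem_free_class)
  moreover have "u \<in> free_class X u"
    using assms by (auto simp: mem_free_class intro: free_eq.refl)
  ultimately show ?thesis unfolding free_subst_def by blast
qed

lemma free_subst_gen:
  "x \<in> X \<Longrightarrow> f ` X \<subseteq> Y \<Longrightarrow> free_subst Y f (free_gen X x) = free_gen Y (f x)"
  by (simp add: free_gen_def free_subst_class)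

lemma free_subst_hom: "f ` X \<subseteq> Y \<Longrightarrow> free_subst Y f \<in> hom (free_group X) (free_group Y)"
  by (auto simp: hom_def carrier_free_group mult_free_class free_subst_class gwords_map)

lemma free_eq_inverse: "free_eq (map (\<lambda>(x, b). (x, \<not> b)) (rev u) @ u) []"
proof (induction u)
  case (Cons a u)
  obtain x b where a: "a = (x, b)" by (cases a)
  show ?case
    using free_eq.trans[OF free_eq.cancel[of "map (\<lambda>(x, b). (x, \<not> b)) (rev u)" x "\<not> b" u] Cons.IH]
    by (simp add: a)
qed (simp add: free_eq.refl)

lemma group_free_group: "group (free_group X)"
proof (rule groupI)
  fix A assume "A \<in> carrier (free_group X)"
  then obtain u where u: "u \<in> gwords X" "A = free_class X u" by (auto simp: carrier_free_group)
  define v where "v = map (\<lambda>(x, b). (x, \<not> b)) (rev u)"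
  have v: "v \<in> gwords X" using u(1) by (auto simp: v_def gwords_def)
  have "free_class X v \<otimes>\<^bsub>free_group X\<^esub> A = \<one>\<^bsub>free_group X\<^esub>"
    using u v free_eq_inverse[of u]
    by (simp add: mult_free_class one_free_group free_class_eq_iff v_def)
  then show "\<exists>B\<in>carrier (free_group X). B \<otimes>\<^bsub>free_group X\<^esub> A = \<one>\<^bsub>free_group X\<^esub>"
    using v by (auto simp: carrier_free_group)
qed (auto simp: carrier_free_group one_free_group mult_free_class)

lemma (in group) normal_closure_normal:
  assumes "S \<subseteq> carrier G"
  shows "normal_closure G S \<lhd> G"
proof -
  let ?F = "{N. N \<lhd> G \<and> S \<subseteq> N}"
  have "carrier G \<lhd> G" by (rule normal_invI) (auto simp: subgroup_self)
  then have ne: "?F \<noteq> {}" using assms by blast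
  have "subgroup (\<Inter>?F) G"
    by (rule subgroups_Inter) (use ne normal_imp_subgroup in auto)
  then show ?thesis
    unfolding normal_closure_def
    by (rule normal_invI) (auto intro: normal.inv_op_closed2)
qed

lemma subset_normal_closure: "S \<subseteq> normal_closure G S"
  by (auto simp: normal_closure_def)

lemma normal_closure_least: "N \<lhd> G \<Longrightarrow> S \<subseteq> N \<Longrightarrow> normal_closure G S \<subseteq> N"
  by (auto simp: normal_closure_def)

lemma group_presented_group:
  "R \<subseteq> carrier (free_group X) \<Longrightarrow> group (presented_group X R)"
  unfolding presented_group_def
  by (intro normal.factorgroup_is_group group.normal_closure_normal group_free_group)

lemma group_cyc_presented_group:
  assumes "w \<in> carrier (free_group {..<n})"
  shows "group (cyc_presented_group n w)"
  unfolding cyc_presented_group_def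
proof (rule group_presented_group, safe)
  fix i assume "i < n"
  then have "(\<lambda>j. (i + j) mod n) ` {..<n} \<subseteq> {..<n}" by auto
  from hom_in_carrier[OF free_subst_hom[OF this] assms]
  show "free_subst {..<n} (\<lambda>j. (i + j) mod n) w \<in> carrier (free_group {..<n})" .
qed

end

theory Submission
  imports Defs "HOL-Algebra.FiniteProduct" "HOL-Computational_Algebra.Polynomial"
    "HOL-Number_Theory.Cong" "HOL-Library.Product_Plus"
begin

text \<open>
  The abelianization of \<open>G\<^sub>n(w)\<close> is the additive group of \<open>\<int>[t] / (t\<^sup>n - 1, f)\<close>, where \<open>f\<close> records the
  exponent sums of \<open>w\<close>. Here \<open>n = 2m\<close> and \<open>t f = t\<^sup>m + t + t\<^sup>2\<close>. In the quotient
  \<open>\<delta> = t\<^sup>2 + t - 1\<close> is fixed by \<open>t\<close> (because \<open>t\<^sup>3 \<delta> = \<delta> = t\<^sup>m \<delta>\<close> and \<open>3\<close> does not divide \<open>m\<close>) and is killed by \<open>3\<close>;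
  it is idempotent and splits off a factor \<open>\<int>\<^sub>3\<close>. The complement, generated by \<open>1 - \<delta>\<close>, is
  \<open>\<int>[t] / (\<delta>, t\<^sup>m + 1)\<close>, and modulo \<open>\<delta>\<close> one has \<open>t\<^sup>m + 1 = \<plusminus> c (a - b t)\<close> with \<open>a\<close>, \<open>b\<close> coprime. A Bezout
  relation for \<open>a\<close> and \<open>b\<close> identifies it with \<open>\<int>/c \<oplus> \<int>/cN\<close>, where \<open>N = a\<^sup>2 + a b - b\<^sup>2\<close>
  is the norm of \<open>a - b t\<close>.
\<close>

section \<open>Abelianizations of cyclically presented groups\<close>

text \<open>Since \<open>h\<close> kills \<open>R\<close> and \<open>H\<close> is commutative,
  \<open>h\<close> factors first through the quotient by the normal closure and then through the
  abelianization. The induced map \<open>k\<close> is onto because \<open>h\<close> is. For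
  injectivity, \<open>ker\<close> is applied to the canonical projection \<open>p\<close>; it is
  phrased for every homomorphism killing \<open>R\<close>, so that no cosets have to be handled when
  it is verified.\<close>

lemma (in group) abelianization_Mod_iso:
  assumes R: "R \<subseteq> carrier G"
    and H: "comm_group H"
    and h: "h \<in> hom G H" "h ` carrier G = carrier H"
    and hR: "\<And>r. r \<in> R \<Longrightarrow> h r = \<one>\<^bsub>H\<^esub>"
    and ker: "\<And>x p. \<lbrakk>x \<in> carrier G; h x = \<one>\<^bsub>H\<^esub>;
       p \<in> hom G (abelianization (G Mod normal_closure G R));
       \<forall>r\<in>R. p r = \<one>\<^bsub>abelianization (G Mod normal_closure G R)\<^esub>\<rbrakk>
       \<Longrightarrow> p x = \<one>\<^bsub>abelianization (G Mod normal_closure G R)\<^esub>"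
  shows "abelianization (G Mod normal_closure G R) \<cong> H"
proof -
  define N where "N = normal_closure G R"
  define Q where "Q = G Mod N"
  define D where "D = derived Q (carrier Q)"
  have A: "abelianization (G Mod normal_closure G R) = Q Mod D"
    by (simp add: abelianization_def Q_def D_def N_def)
  interpret H: comm_group H by fact
  interpret h: group_hom G H h by unfold_locales (use h in auto)
  interpret N: normal N G unfolding N_def by (rule normal_closure_normal[OF R])
  interpret Q: group Q unfolding Q_def by (rule N.factorgroup_is_group)
  interpret D: normal D Q unfolding D_def by (rule Q.derived_self_is_normal)
  interpret A: group "Q Mod D" by (rule D.factorgroup_is_group)
  have "N \<subseteq> kernel G H h"
    unfolding N_def by (rule normal_closure_least[OF h.normal_kernel]) (use R hR in \<open>auto simp: kernel_def\<close>)
  then obtain g where g: "g \<in> hom Q H" "\<And>x. x \<in> carrier G \<Longrightarrow> g (N #> x) = h x"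
    using h.FactGroup_universal_kernel[OF N.normal_axioms] unfolding Q_def by metis
  interpret g: group_hom Q H g by unfold_locales (use g in auto)
  have "g ` D = derived H (g ` carrier Q)"
    unfolding D_def by (rule g.derived_img[symmetric]) simp
  also have "\<dots> = {\<one>\<^bsub>H\<^esub>}"
    by (rule H.derived_eq_singleton) auto
  finally have "D \<subseteq> kernel Q H g"
    using D.subset by (auto simp: kernel_def)
  then obtain k where k: "k \<in> hom (Q Mod D) H" "\<And>x. x \<in> carrier Q \<Longrightarrow> k (D #>\<^bsub>Q\<^esub> x) = g x"
    using g.FactGroup_universal_kernel[OF D.normal_axioms] by metis
  interpret k: group_hom "Q Mod D" H k by unfold_locales (use k in auto)
  define p where "p x = D #>\<^bsub>Q\<^esub> (N #> x)" for x
  have Q_mem: "N #> x \<in> carrier Q" if "x \<in> carrier G" for x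
    using hom_in_carrier[OF N.r_coset_hom_Mod that] by (simp add: Q_def)
  have p: "p \<in> hom G (Q Mod D)"
    unfolding p_def using Group.hom_compose[OF N.r_coset_hom_Mod, folded Q_def, OF D.r_coset_hom_Mod]
    by (simp add: o_def)
  have kp: "k (p x) = h x" if "x \<in> carrier G" for x
    using that by (simp add: p_def k g Q_mem)
  have surj: "\<exists>x\<in>carrier G. a = p x" if a: "a \<in> carrier (Q Mod D)" for a
  proof -
    obtain q where q: "q \<in> carrier Q" "a = D #>\<^bsub>Q\<^esub> q"
      using a by (auto simp: FactGroup_def RCOSETS_def)
    then obtain x where "x \<in> carrier G" "q = N #> x"
      by (auto simp: Q_def FactGroup_def RCOSETS_def)
    with q show ?thesis by (auto simp: p_def)
  qed
  have pR: "p r = \<one>\<^bsub>Q Mod D\<^esub>" if "r \<in> R" for r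
  proof -
    have "r \<in> N" using that subset_normal_closure[of R G] by (auto simp: N_def)
    then have "N #> r = \<one>\<^bsub>Q\<^esub>"
      by (simp add: N.rcos_const Q_def FactGroup_def)
    then show ?thesis using D.rcos_const by (simp add: p_def FactGroup_def)
  qed
  have "k \<in> iso (Q Mod D) H"
    unfolding k.iso_iff
  proof (intro conjI subsetI ballI impI)
    fix y assume "y \<in> carrier H"
    then obtain x where "x \<in> carrier G" "y = h x" using h by auto
    then show "y \<in> k ` carrier (Q Mod D)"
      using kp hom_in_carrier[OF p] by (intro image_eqI[of _ _ "p x"]) auto
  next
    fix a assume a: "a \<in> carrier (Q Mod D)" "k a = \<one>\<^bsub>H\<^esub>"
    then obtain x where x: "x \<in> carrier G" "a = p x" using surj by blast
    then have "h x = \<one>\<^bsub>H\<^esub>" using a kp by simp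
    with x show "a = \<one>\<^bsub>Q Mod D\<^esub>"
      using ker[unfolded A, OF _ _ p] pR by blast
  qed
  then show ?thesis unfolding A by (rule is_isoI)
qed

section \<open>Exponent sums of words as integer polynomials\<close>

fun word_poly :: "nat gword \<Rightarrow> int poly" where
  "word_poly [] = 0"
| "word_poly ((i, b) # u) = monom (if b then 1 else -1) i + word_poly u"

lemma word_poly_append [simp]: "word_poly (u @ v) = word_poly u + word_poly v"
  by (induction u rule: word_poly.induct) auto

lemma word_poly_free_eq: "free_eq u v \<Longrightarrow> word_poly u = word_poly v"
proof (induction rule: free_eq.induct)
  case (cancel u x b v)
  show ?case by (cases b) (simp_all add: add_monom flip: add.assoc)
qed auto

definition word_inv :: "'a gword \<Rightarrow> 'a gword" where
  "word_inv u = map (\<lambda>(x, b). (x, \<not> b)) (rev u)"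

lemma word_poly_inv: "word_poly (word_inv u) = - word_poly u"
  by (induction u rule: word_poly.induct) (auto simp: word_inv_def simp flip: minus_monom)

lemma word_inv_gwords: "u \<in> gwords X \<Longrightarrow> word_inv u \<in> gwords X"
  by (auto simp: word_inv_def gwords_def)

lemma degree_word_poly:
  assumes "u \<in> gwords {..<n}" "n \<ge> 1"
  shows "degree (word_poly u) < n"
  using assms(1)
proof (induction u rule: word_poly.induct)
  case (2 i b u)
  then have "degree (monom (if b then 1 else - 1 :: int) i) < n"
    by (auto simp: degree_monom_eq)
  with 2 show ?case by (auto intro!: degree_add_less)
qed (use assms in auto)

definition shift :: "nat \<Rightarrow> nat \<Rightarrow> nat gword \<Rightarrow> nat gword" where
  "shift n i = map (apfst (\<lambda>j. (i + j) mod n))"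

lemma shift_gwords: "n \<ge> 1 \<Longrightarrow> u \<in> gwords {..<n} \<Longrightarrow> shift n i u \<in> gwords {..<n}"
  unfolding shift_def by (rule gwords_map) auto

lemma shift_mod: "shift n (i mod n) = shift n i"
  by (simp add: shift_def mod_add_left_eq)

lemma dvd_monom_diff:
  "monom 1 n - 1 dvd (monom c (i mod n) - monom c i :: 'a::comm_ring_1 poly)"
proof -
  have "monom 1 n - 1 dvd monom 1 n ^ (i div n) - (1 :: 'a poly)"
    by (metis dvd_triv_left power_diff_1_eq)
  then have "monom 1 n - 1 dvd monom c (i mod n) * (monom 1 n ^ (i div n) - 1)"
    by (rule dvd_mult)
  also have "\<dots> = monom c i - monom c (i mod n)"
    by (simp add: algebra_simps monom_power mult_monom)
  finally show ?thesis by (metis dvd_minus_iff minus_diff_eq)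
qed

text \<open>This turns the cyclic family of relators into an ideal: the shifts of one word account
  for all multiples of its polynomial by powers of \<open>t\<close>, once
  \<open>t^n = 1\<close>.\<close>

lemma word_poly_shift: "monom 1 n - 1 dvd word_poly (shift n i u) - monom 1 i * word_poly u"
proof (induction u rule: word_poly.induct)
  case (2 j b u)
  have "word_poly (shift n i ((j, b) # u)) - monom 1 i * word_poly ((j, b) # u) =
     (monom (if b then 1 else -1) ((i + j) mod n) - monom (if b then 1 else -1) (i + j)) +
     (word_poly (shift n i u) - monom 1 i * word_poly u)"
    by (simp add: shift_def algebra_simps mult_monom)
  with 2 dvd_monom_diff show ?case by (metis dvd_add)
qed (simp add: shift_def)

text \<open>Up to multiples of \<open>d\<close>, the polynomials realised by words of
  \<open>V\<close> form an additive group containing every \<open>t^i g\<close>, hence every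
  multiple of \<open>g\<close>. This is used with \<open>g = 1\<close> for surjectivity, and with
  \<open>g\<close> the relator polynomial for the kernel.\<close>

lemma word_realising_multiple:
  fixes g :: "int poly"
  assumes "[] \<in> V" and app: "\<And>u v. u \<in> V \<Longrightarrow> v \<in> V \<Longrightarrow> u @ v \<in> V"
    and inv: "\<And>u. u \<in> V \<Longrightarrow> word_inv u \<in> V"
    and gen: "\<And>i. \<exists>v\<in>V. d dvd word_poly v - monom 1 i * g"
  shows "\<exists>v\<in>V. d dvd word_poly v - r * g"
proof -
  define P where "P = (\<lambda>p. \<exists>v\<in>V. d dvd word_poly v - p)"
  have 0: "P 0" using assms(1) by (auto simp: P_def intro: bexI[of _ "[]"])
  have add: "P (p + q)" if "P p" "P q" for p q
  proof -
    obtain u v where "u \<in> V" "v \<in> V" "d dvd word_poly u - p" "d dvd word_poly v - q"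
      using \<open>P p\<close> \<open>P q\<close> by (auto simp: P_def)
    moreover have "word_poly (u @ v) - (p + q) = (word_poly u - p) + (word_poly v - q)" by simp
    ultimately show ?thesis unfolding P_def using app by (metis dvd_add)
  qed
  have neg: "P (- p)" if P: "P p" for p
  proof -
    obtain u where "u \<in> V" "d dvd word_poly u - p"
      using P by (auto simp: P_def)
    moreover have "word_poly (word_inv u) - (- p) = - (word_poly u - p)"
      by (simp add: word_poly_inv)
    ultimately show ?thesis unfolding P_def using inv by (metis dvd_minus_iff)
  qed
  have smult: "P (smult c p)" if "P p" for c p
  proof (induction c rule: int_induct[where k = 0])
    case (step1 i)
    then show ?case using add[OF _ that] by (simp add: smult_add_left)
  next
    case (step2 i)
    then show ?case using add[OF _ neg[OF that]] by (simp add: smult_diff_left)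
  qed (simp add: 0)
  \<comment> \<open>The extra factor \<open>t^i\<close> makes the induction on \<open>r\<close> go
    through, since removing the constant coefficient raises the exponent by one.\<close>
  have "P (monom 1 i * (r * g))" for i
  proof (induction r arbitrary: i)
    case (pCons a r)
    have "monom 1 i * (pCons a r * g) = smult a (monom 1 i * g) + monom 1 (Suc i) * (r * g)"
      by (simp add: algebra_simps monom_Suc)
    with add smult gen pCons show ?case by (simp add: P_def)
  qed (simp add: 0)
  from this[of 0] show ?thesis by (simp add: P_def)
qed

text \<open>A homomorphism into a commutative group sees only the exponent sums, so words with equal
  polynomials have equal images.\<close>

lemma (in comm_group) hom_free_class:
  assumes p: "p \<in> hom (free_group X) G" and "finite X"
    and "u \<in> gwords (X :: nat set)"
  shows "p (free_class X u) = (\<Otimes>i\<in>X. p (free_gen X i) [^] coeff (word_poly u) i)"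
proof -
  interpret F: group "free_group X" by (rule group_free_group)
  interpret p: group_hom "free_group X" G p by unfold_locales (rule p)
  have gen: "free_gen X i \<in> carrier (free_group X)" if "i \<in> X" for i
    using that by (auto simp: free_gen_def carrier_free_group)
  have letter: "p (free_class X [(x, b)]) = p (free_gen X x) [^] (if b then 1 else -1 :: int)"
    if x: "x \<in> X" for x b
  proof (cases b)
    case False
    have "free_class X [(x, False)] \<otimes>\<^bsub>free_group X\<^esub> free_gen X x = \<one>\<^bsub>free_group X\<^esub>"
      using x free_eq.cancel[of "[]" x False "[]"]
      by (simp add: free_gen_def mult_free_class one_free_group free_class_eq_iff)
    then have "free_class X [(x, False)] = inv\<^bsub>free_group X\<^esub> free_gen X x"
      using x gen by (intro F.inv_equality[symmetric]) (auto simp: carrier_free_group)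
    then show ?thesis using False x gen by (simp add: int_pow_neg)
  qed (use x gen in \<open>auto simp: free_gen_def\<close>)
  show ?thesis
    using assms(3)
  proof (induction u rule: word_poly.induct)
    case 1
    have "p (free_class X []) = \<one>" using p.hom_one by (simp add: one_free_group)
    then show ?case by simp
  next
    case (2 x b u)
    define e :: int where "e = (if b then 1 else -1)"
    let ?y = "\<lambda>i. p (free_gen X i)"
    have x: "x \<in> X" "u \<in> gwords X" using 2 by auto
    have y: "?y i \<in> carrier G" if "i \<in> X" for i using that gen by auto
    have "p (free_class X ((x, b) # u)) = p (free_class X [(x, b)]) \<otimes> p (free_class X u)"
      using mult_free_class[of "[(x,b)]" X u] x hom_mult[OF p]
      by (metis append_Cons append_Nil carrier_free_group gwords_Cons gwords_Nil image_eqI)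
    also have "p (free_class X [(x, b)]) = (\<Otimes>i\<in>X. if x = i then ?y i [^] e else \<one>)"
      using x y \<open>finite X\<close> letter[of x b] by (subst finprod_singleton) (auto simp: e_def)
    also have "\<dots> = (\<Otimes>i\<in>X. ?y i [^] coeff (monom e x) i)"
      using y by (intro finprod_cong') auto
    also have "p (free_class X u) = (\<Otimes>i\<in>X. ?y i [^] coeff (word_poly u) i)"
      using 2 by auto
    also have "(\<Otimes>i\<in>X. ?y i [^] coeff (monom e x) i) \<otimes> \<dots> =
       (\<Otimes>i\<in>X. ?y i [^] coeff (monom e x) i \<otimes> ?y i [^] coeff (word_poly u) i)"
      using y by (subst finprod_multf) auto
    also have "\<dots> = (\<Otimes>i\<in>X. ?y i [^] coeff (word_poly ((x, b) # u)) i)"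
      using y by (intro finprod_cong') (auto simp: e_def int_pow_mult)
    finally show ?case .
  qed
qed

text \<open>The group is presented to the outside as the image of any additive surjection \<Lambda>
  on integer polynomials whose kernel is the ideal of \<open>t^n - 1\<close> and the relator
  polynomial. The isomorphism comes from sending a word to \<Lambda> of its exponent sum
  polynomial.\<close>

theorem abelianization_cyc_presented_group_iso:
  fixes \<Lambda> :: "int poly \<Rightarrow> 'a" and H :: "'a monoid"
  assumes n: "n \<ge> 1" and w: "w \<in> gwords {..<n}"
    and H: "group H"
    and add: "\<And>p q. \<Lambda> (p + q) = \<Lambda> p \<otimes>\<^bsub>H\<^esub> \<Lambda> q"
    and range: "range \<Lambda> = carrier H"
    and ker: "\<And>p. \<Lambda> p = \<one>\<^bsub>H\<^esub> \<longleftrightarrow> (\<exists>q r. p = q * (monom 1 n - 1) + r * word_poly w)"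
  shows "abelianization (cyc_presented_group n (free_class {..<n} w)) \<cong> H"
proof -
  let ?X = "{..<n}"
  let ?F = "free_group ?X"
  let ?d = "monom 1 n - 1 :: int poly"
  interpret H: group H by fact
  have HC: "comm_group H"
  proof (rule H.group_comm_groupI)
    fix x y assume "x \<in> carrier H" "y \<in> carrier H"
    then obtain p q where "x = \<Lambda> p" "y = \<Lambda> q" using range by (metis rangeE)
    then show "x \<otimes>\<^bsub>H\<^esub> y = y \<otimes>\<^bsub>H\<^esub> x" using add[of p q] add[of q p] by (simp add: add.commute)
  qed
  interpret F: group ?F by (rule group_free_group)
  define R where "R = (\<lambda>i. free_class ?X (shift n i w)) ` ?X"
  have shift_w: "shift n i w \<in> gwords ?X" for i using n w by (rule shift_gwords)
  have R: "R \<subseteq> carrier ?F" by (auto simp: R_def carrier_free_group shift_w)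
  have "free_subst ?X (\<lambda>j. (i + j) mod n) (free_class ?X w) = free_class ?X (shift n i w)" if "i < n" for i
    using w that unfolding shift_def by (intro free_subst_class) auto
  then have G: "cyc_presented_group n (free_class ?X w) = ?F Mod normal_closure ?F R"
    by (simp add: cyc_presented_group_def presented_group_def R_def)
  have closed: "\<Lambda> p \<in> carrier H" for p using range by blast
  have kerD: "\<Lambda> p = \<Lambda> q" if pq: "?d dvd p - q" for p q
  proof -
    obtain r where "p - q = r * ?d + 0 * word_poly w"
      using pq by (metis add_0_right dvdE mult.commute mult_zero_left)
    then have "\<Lambda> (p - q) = \<one>\<^bsub>H\<^esub>" using ker by blast
    moreover have "\<Lambda> p = \<Lambda> (p - q) \<otimes>\<^bsub>H\<^esub> \<Lambda> q" using add[of "p - q" q] by simp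
    ultimately show ?thesis using closed by simp
  qed
  \<comment> \<open>The choice of representative is harmless because \<open>word_poly\<close> is
    invariant under free equivalence.\<close>
  define h where "h A = \<Lambda> (word_poly (SOME u. u \<in> A))" for A
  have h: "h (free_class ?X u) = \<Lambda> (word_poly u)" if u: "u \<in> gwords ?X" for u
  proof -
    have "u \<in> free_class ?X u" using u by (simp add: mem_free_class free_eq.refl)
    then have "(SOME v. v \<in> free_class ?X u) \<in> free_class ?X u" by (rule someI)
    then show ?thesis using u word_poly_free_eq by (metis h_def mem_free_class)
  qed
  have hom: "h \<in> hom ?F H"
    using closed by (auto simp: hom_def carrier_free_group mult_free_class h add)
  show ?thesis
    unfolding G
  proof (rule F.abelianization_Mod_iso[OF R HC hom])
    show "h ` carrier ?F = carrier H"
    proof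
      show "carrier H \<subseteq> h ` carrier ?F"
      proof
        fix y assume "y \<in> carrier H"
        then obtain p where p: "y = \<Lambda> p" using range by auto
        have "\<exists>v\<in>gwords ?X. ?d dvd word_poly v - p * 1"
        proof (rule word_realising_multiple)
          fix i show "\<exists>v\<in>gwords ?X. ?d dvd word_poly v - monom 1 i * 1"
            using dvd_monom_diff[of n 1 i] n by (intro bexI[of _ "[(i mod n, True)]"]) auto
        qed (auto intro: word_inv_gwords)
        then obtain v where v: "v \<in> gwords ?X" "?d dvd word_poly v - p" by auto
        then have "y = h (free_class ?X v)" using kerD p h by simp
        then show "y \<in> h ` carrier ?F" using v by (auto simp: carrier_free_group)
      qed
    qed (use hom in \<open>auto simp: hom_def\<close>)
  next
    fix r assume "r \<in> R"
    then obtain i where i: "i < n" "r = free_class ?X (shift n i w)" by (auto simp: R_def)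
    have "h r = \<Lambda> (monom 1 i * word_poly w)"
      unfolding i using h[OF shift_w] kerD[OF word_poly_shift] by simp
    also have "\<dots> = \<one>\<^bsub>H\<^esub>"
      unfolding ker by (metis add_0 mult_zero_left)
    finally show "h r = \<one>\<^bsub>H\<^esub>" .
  next
    let ?A = "abelianization (?F Mod normal_closure ?F R)"
    fix x p assume x: "x \<in> carrier ?F" "h x = \<one>\<^bsub>H\<^esub>"
      and p: "p \<in> hom ?F ?A" and pR: "\<forall>r\<in>R. p r = \<one>\<^bsub>?A\<^esub>"
    interpret Q: group "?F Mod normal_closure ?F R"
      by (intro normal.factorgroup_is_group F.normal_closure_normal R)
    interpret A: comm_group ?A
      unfolding abelianization_def by (rule Q.derived_quot_is_comm_group)
    interpret p: group_hom ?F ?A p by unfold_locales (rule p)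
    obtain u where u: "u \<in> gwords ?X" "x = free_class ?X u" using x by (auto simp: carrier_free_group)
    then obtain q r where qr: "word_poly u = q * ?d + r * word_poly w"
      using x h ker by auto
    \<comment> \<open>The words killed by \<open>p\<close>. They include the shifts of
      \<open>w\<close> by every \<open>i\<close>, as a shift depends only on \<open>i mod n\<close>,
      so some word of \<open>V\<close> realises \<open>r * word_poly w\<close> modulo
      \<open>t^n - 1\<close>.\<close>
    define V where "V = {v \<in> gwords ?X. p (free_class ?X v) = \<one>\<^bsub>?A\<^esub>}"
    have fc: "free_class ?X v \<in> carrier ?F" if "v \<in> gwords ?X" for v
      using that by (auto simp: carrier_free_group)
    have "\<exists>v\<in>V. ?d dvd word_poly v - r * word_poly w"
    proof (rule word_realising_multiple)
      show "[] \<in> V" using p.hom_one by (simp add: V_def one_free_group)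
    next
      fix u v assume "u \<in> V" "v \<in> V"
      then show "u @ v \<in> V" using fc by (auto simp: V_def simp flip: mult_free_class)
    next
      fix u assume "u \<in> V"
      then have u: "u \<in> gwords ?X" "p (free_class ?X u) = \<one>\<^bsub>?A\<^esub>" by (auto simp: V_def)
      have "free_class ?X (word_inv u) \<otimes>\<^bsub>?F\<^esub> free_class ?X u = \<one>\<^bsub>?F\<^esub>"
        using u word_inv_gwords[OF u(1)] free_eq_inverse[of u]
        by (simp add: mult_free_class one_free_group free_class_eq_iff word_inv_def)
      then have "p (free_class ?X (word_inv u)) \<otimes>\<^bsub>?A\<^esub> p (free_class ?X u) = \<one>\<^bsub>?A\<^esub>"
        using u fc word_inv_gwords[OF u(1)] by (metis p.hom_mult p.hom_one)
      then show "word_inv u \<in> V" using u word_inv_gwords[OF u(1)] fc by (simp add: V_def)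
    next
      fix i
      have "free_class ?X (shift n (i mod n) w) \<in> R" using n by (auto simp: R_def)
      then have "shift n i w \<in> V" using pR shift_w by (simp add: V_def shift_mod)
      then show "\<exists>v\<in>V. ?d dvd word_poly v - monom 1 i * word_poly w"
        using word_poly_shift by blast
    qed
    then obtain v where v: "v \<in> gwords ?X" "p (free_class ?X v) = \<one>\<^bsub>?A\<^esub>"
      "?d dvd word_poly v - r * word_poly w" by (auto simp: V_def)
    have "word_poly u - word_poly v = q * ?d - (word_poly v - r * word_poly w)"
      using qr by simp
    then have dvd: "?d dvd word_poly u - word_poly v"
      using v(3) by (metis dvd_diff dvd_triv_right)
    \<comment> \<open>Both words use only generators below \<open>n\<close>, so congruence modulo
      \<open>t^n - 1\<close>, of degree \<open>n\<close>, is equality.\<close>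
    have "degree (word_poly u - word_poly v) < n"
      using degree_word_poly u v n by (intro degree_diff_less) auto
    moreover have "degree ?d = n"
      using degree_add_eq_left[of "-1" "monom 1 n :: int poly"] n by (simp add: degree_monom_eq)
    ultimately have "word_poly u = word_poly v"
      using dvd_imp_degree_le[OF dvd] by auto
    then have "p (free_class ?X u) = p (free_class ?X v)"
      using A.hom_free_class[OF p, of u] A.hom_free_class[OF p, of v] u v by simp
    then show "p x = \<one>\<^bsub>?A\<^esub>" using u v by simp
  qed
qed

section \<open>Cyclic groups and division by \<open>t\<^sup>2 + t - 1\<close>\<close>

lemma integer_mod_group_mod_closed [simp]: "x mod int n \<in> carrier (integer_mod_group n)"
  by (simp add: carrier_integer_mod_group)

lemma integer_mod_group_crt:
  assumes "coprime m n" "m > 0" "n > 0"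
  shows "integer_mod_group (m * n) \<cong> integer_mod_group m \<times>\<times> integer_mod_group n"
proof -
  let ?h = "\<lambda>x :: int. (x mod int m, x mod int n)"
  have hom: "?h \<in> hom (integer_mod_group (m * n)) (integer_mod_group m \<times>\<times> integer_mod_group n)"
    by (rule homI) (auto simp: mod_mod_cancel mod_simps)
  interpret h: group_hom "integer_mod_group (m * n)" "integer_mod_group m \<times>\<times> integer_mod_group n" ?h
    by (intro group_hom.intro group_hom_axioms.intro hom DirProd_group group_integer_mod_group)
  have "?h \<in> iso (integer_mod_group (m * n)) (integer_mod_group m \<times>\<times> integer_mod_group n)"
    unfolding h.iso_iff
  proof safe
    fix a b assume ab: "(a, b) \<in> carrier (integer_mod_group m \<times>\<times> integer_mod_group n)"
    then have ab': "a mod int m = a" "b mod int n = b"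
      using assms by (auto simp: carrier_integer_mod_group)
    obtain x where x: "[x = a] (mod (int m))" "[x = b] (mod (int n))"
      using binary_chinese_remainder_int[of "int m" "int n" a b] assms by auto
    have "?h (x mod int (m * n)) = (a, b)"
      using x ab' by (simp add: cong_def mod_mod_cancel)
    then show "(a, b) \<in> ?h ` carrier (integer_mod_group (m * n))"
      by (intro image_eqI[where x = "x mod int (m * n)"]) (auto simp del: of_nat_mult)
  next
    fix x assume x: "x \<in> carrier (integer_mod_group (m * n))" "?h x = \<one>\<^bsub>integer_mod_group m \<times>\<times> integer_mod_group n\<^esub>"
    then have "int m dvd x" "int n dvd x" by (auto simp: mod_eq_0_iff_dvd)
    then have "int (m * n) dvd x" using assms by (simp add: divides_mult)
    then have "x mod int (m * n) = 0" by simp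
    then show "x = \<one>\<^bsub>integer_mod_group (m * n)\<^esub>"
      using x assms by (simp add: carrier_integer_mod_group)
  qed
  then show ?thesis by (rule is_isoI)
qed

definition fib_poly :: "int poly" where
  "fib_poly = [:-1, 1, 1:]"

text \<open>
  Modulo \<open>fib_poly\<close>, a polynomial is congruent to \<open>x + y t\<close> with \<open>(x, y)\<close> the value of
  \<open>fib_rem\<close>; the recursion comes from \<open>t (x + y t) \<equiv> y + (x - y) t\<close>.
\<close>

definition fib_rem :: "int poly \<Rightarrow> int \<times> int" where
  "fib_rem p = fold_coeffs (\<lambda>a (x, y). (a + y, x - y)) p (0, 0)"

lemma fib_rem_0 [simp]: "fib_rem 0 = (0, 0)"
  by (simp add: fib_rem_def)

lemma fib_rem_pCons [simp]:
  "fib_rem (pCons a p) = (a + snd (fib_rem p), fst (fib_rem p) - snd (fib_rem p))"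
  by (cases "pCons a p = 0") (auto simp: fib_rem_def split: prod.splits)

lemma fib_rem_add: "fib_rem (p + q) = fib_rem p + fib_rem q"
  by (induction p q rule: poly_induct2) (simp_all add: plus_prod_def)

lemma fib_rem_smult: "fib_rem (smult c p) = (c * fst (fib_rem p), c * snd (fib_rem p))"
  by (induction p) (simp_all add: algebra_simps)

lemma fib_rem_mult_fib_poly [simp]: "fib_rem (fib_poly * q) = (0, 0)"
  by (induction q) (simp_all add: fib_poly_def fib_rem_add fib_rem_smult plus_prod_def)

lemma fib_rem_cong:
  assumes "fib_poly dvd p - q"
  shows "fib_rem p = fib_rem q"
proof -
  obtain r where "p = fib_poly * r + q" using assms by (auto simp: dvd_def algebra_simps)
  then show ?thesis by (simp add: fib_rem_add plus_prod_def)
qed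

lemma fib_poly_dvd_fib_rem: "fib_poly dvd p - [:fst (fib_rem p), snd (fib_rem p):]"
proof (induction p)
  case (pCons a p)
  obtain x y where xy: "fib_rem p = (x, y)" by fastforce
  have "pCons a p - [:fst (fib_rem (pCons a p)), snd (fib_rem (pCons a p)):] =
    [:0, 1:] * (p - [:x, y:]) + [:y:] * fib_poly"
    by (simp add: xy fib_poly_def)
  then show ?case using pCons xy by (metis dvd_add dvd_mult dvd_triv_right fst_conv snd_conv)
qed simp

text \<open>The negative of the golden ratio is a root of \<open>fib_poly\<close>, so this is the
  usual expansion of powers of the golden ratio with alternating signs. Starting at exponent
  \<open>Suc m\<close> avoids a Fibonacci number of index -1.\<close>

lemma fib_poly_dvd_monom:
  "fib_poly dvd monom 1 (Suc m) - smult ((-1) ^ m) [:- int (fib m), int (fib (Suc m)):]"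
proof (induction m)
  case (Suc m)
  have "monom 1 (Suc (Suc m)) - smult ((-1) ^ Suc m) [:- int (fib (Suc m)), int (fib (Suc (Suc m))):] =
    [:0, 1:] * (monom 1 (Suc m) - smult ((-1) ^ m) [:- int (fib m), int (fib (Suc m)):])
    + smult ((-1) ^ m * int (fib (Suc m))) fib_poly"
    by (simp add: fib_poly_def monom_Suc algebra_simps)
  then show ?case using Suc by (metis dvd_add dvd_mult dvd_smult dvd_refl)
qed (simp add: monom_Suc one_pCons)

section \<open>The ideal of the relators\<close>

text \<open>The exponent sums of \<open>x_0 x_1 x_(m-1)\<close>. For \<open>m = 1\<close> and
  \<open>m = 2\<close> two of the letters coincide and their monomials add up.\<close>

definition relator :: "nat \<Rightarrow> int poly" where
  "relator m = 1 + [:0, 1:] + monom 1 (m - 1)"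

definition relator_ideal :: "nat \<Rightarrow> int poly set" where
  "relator_ideal m = {q * (monom 1 (2 * m) - 1) + r * relator m | q r. True}"

lemma relator_ideal_add: "p \<in> relator_ideal m \<Longrightarrow> q \<in> relator_ideal m \<Longrightarrow> p + q \<in> relator_ideal m"
proof -
  assume "p \<in> relator_ideal m" "q \<in> relator_ideal m"
  then obtain a b c d where "p = a * (monom 1 (2 * m) - 1) + b * relator m"
    "q = c * (monom 1 (2 * m) - 1) + d * relator m" by (auto simp: relator_ideal_def)
  then have "p + q = (a + c) * (monom 1 (2 * m) - 1) + (b + d) * relator m" by (simp add: algebra_simps)
  then show ?thesis by (auto simp: relator_ideal_def)
qed

lemma relator_ideal_mult: "p \<in> relator_ideal m \<Longrightarrow> q * p \<in> relator_ideal m"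
proof -
  assume "p \<in> relator_ideal m"
  then obtain a b where "p = a * (monom 1 (2 * m) - 1) + b * relator m"
    by (auto simp: relator_ideal_def)
  then have "q * p = (q * a) * (monom 1 (2 * m) - 1) + (q * b) * relator m" by (simp only: distrib_left mult.assoc)
  then show ?thesis by (auto simp: relator_ideal_def)
qed

lemma relator_ideal_diff: "p \<in> relator_ideal m \<Longrightarrow> q \<in> relator_ideal m \<Longrightarrow> p - q \<in> relator_ideal m"
  using relator_ideal_add[of p m "(-1) * q"] relator_ideal_mult[of q m "-1"] by simp

section \<open>Relations in the quotient by the relator ideal\<close>

context
  fixes m :: nat and I :: "int poly set" and t :: "int poly" and \<delta> :: "int poly"
  assumes m: "m \<ge> 1" "\<not> 3 dvd m"
  defines "I \<equiv> relator_ideal m" and "t \<equiv> [:0, 1:]" and "\<delta> \<equiv> fib_poly"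
begin

lemmas I_add = relator_ideal_add[of _ m, folded I_def]
lemmas I_diff = relator_ideal_diff[of _ m, folded I_def]
lemmas I_mult = relator_ideal_mult[of _ m, folded I_def]

lemma delta_eq: "\<delta> = t ^ 2 + t - 1"
  by (simp add: \<delta>_def fib_poly_def t_def power2_eq_square one_pCons)

lemma monom_eq_t_power: "monom 1 k = t ^ k"
  by (simp add: t_def monom_altdef)

lemma t_relator: "t * relator m = t ^ m + t + t ^ 2"
  using m by (cases m) (simp_all add: relator_def monom_eq_t_power algebra_simps power2_eq_square flip: t_def)

lemma I_t_power: "t ^ m + t + t ^ 2 \<in> I"
proof -
  have "relator m \<in> I"
    unfolding I_def relator_ideal_def by (intro CollectI exI[of _ 0] exI[of _ 1]) simp
  then show ?thesis using I_mult[of "relator m" t] by (simp add: t_relator)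
qed

lemma I_t_power_2: "t ^ (2 * m) - 1 \<in> I"
  unfolding I_def relator_ideal_def
  by (intro CollectI exI[of _ 1] exI[of _ 0]) (simp add: monom_eq_t_power)

text \<open>Modulo \<open>I\<close>, \<open>t^m\<close> is \<open>-(t^2 + t)\<close>, and its square
  is \<open>t^(2m) = 1\<close>.\<close>

lemma I_square: "(t ^ 2 + t) ^ 2 - 1 \<in> I"
proof -
  have "(t ^ 2 + t) ^ 2 - 1 = (t ^ 2 + t - t ^ m) * (t ^ m + t + t ^ 2) + (t ^ (2 * m) - 1)"
    by (simp add: algebra_simps power2_eq_square power_mult mult_2 power_add)
  then show ?thesis using I_add I_mult I_t_power I_t_power_2 by metis
qed

text \<open>With \<open>u = t^2 + t\<close> one has \<open>u^2 - 1 = \<delta> (t^2 + t + 1)\<close>;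
  multiplying by \<open>t - 1\<close> shows that \<open>t^3\<close> fixes \<delta>. Replacing
  \<open>t^m\<close> by \<open>-u\<close> shows that \<open>t^m\<close> fixes \<delta> too. As 3 and
  \<open>m\<close> are coprime, \<open>t\<close> fixes \<delta>.\<close>

lemma I_t_delta: "(t - 1) * \<delta> \<in> I"
proof -
  let ?u = "t ^ 2 + t"
  have cube: "(t ^ 3 - 1) * \<delta> \<in> I"
  proof -
    have "(t ^ 3 - 1) * \<delta> = (t - 1) * (?u ^ 2 - 1)"
      unfolding delta_eq by algebra
    then show ?thesis using I_mult I_square by metis
  qed
  have cubes: "(t ^ (3 * j) - 1) * \<delta> \<in> I" for j
  proof -
    have "t ^ (3 * j) - 1 = (t ^ 3 - 1) * (\<Sum>i<j. (t ^ 3) ^ i)"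
      unfolding power_mult by (rule power_diff_1_eq)
    then have "(t ^ (3 * j) - 1) * \<delta> = (\<Sum>i<j. (t ^ 3) ^ i) * ((t ^ 3 - 1) * \<delta>)"
      by (simp add: mult.commute mult.left_commute)
    then show ?thesis using I_mult cube by metis
  qed
  have tm: "(t ^ m - 1) * \<delta> \<in> I"
  proof -
    have "(t ^ m - 1) * \<delta> = \<delta> * (t ^ m + t + t ^ 2) - (?u ^ 2 - 1)"
      unfolding delta_eq by algebra
    then show ?thesis using I_diff I_mult I_square I_t_power by metis
  qed
  define j where "j = m div 3"
  have "m = 3 * j + 1 \<or> m = 3 * j + 2" using m unfolding j_def by presburger
  then consider "m = 3 * j + 1" | "m = 3 * j + 2" by blast
  then show ?thesis
  proof cases
    case 1
    have "(t - 1) * \<delta> = (t ^ m - 1) * \<delta> - t * ((t ^ (3 * j) - 1) * \<delta>)"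
      by (simp add: 1 algebra_simps)
    then show ?thesis using I_diff I_mult tm cubes by metis
  next
    \<comment> \<open>Here \<open>t^2\<close> fixes \<delta>, and comparison with \<open>t^3\<close>
      gives the same for \<open>t\<close>.\<close>
    case 2
    have "t ^ m = t ^ (3 * j) * t ^ 2" by (simp add: 2 power_add power2_eq_square)
    then have "(t - 1) * \<delta> = (t ^ 3 - 1) * \<delta> - t * ((t ^ m - 1) * \<delta> - t ^ 2 * ((t ^ (3 * j) - 1) * \<delta>))"
      by (simp add: algebra_simps power2_eq_square power3_eq_cube)
    then show ?thesis using I_diff I_mult tm cubes cube by metis
  qed
qed

text \<open>In \<open>\<delta> (t^2 + t + 1) = u^2 - 1\<close>, which vanishes, \<open>t\<close>
  acts on \<delta> as 1, so the cofactor acts as 3.\<close>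

lemma I_3_delta: "3 * \<delta> \<in> I"
proof -
  have "3 * \<delta> = ((t ^ 2 + t) ^ 2 - 1) - (t + 2) * ((t - 1) * \<delta>)"
    unfolding delta_eq by algebra
  then show ?thesis using I_diff I_mult I_square I_t_delta by metis
qed

text \<open>Since \<open>u = \<delta> + 1\<close>, the relation \<open>u^2 = 1\<close> reads
  \<open>\<delta>^2 + 2 \<delta> = 0\<close>; adding \<open>3 \<delta> = 0\<close> gives
  idempotence.\<close>

lemma I_delta_idem: "\<delta> * (1 - \<delta>) \<in> I"
proof -
  have "\<delta> * (1 - \<delta>) = 3 * \<delta> - ((t ^ 2 + t) ^ 2 - 1)"
    unfolding delta_eq by algebra
  then show ?thesis using I_diff I_3_delta I_square by metis
qed

lemma I_t_power_add_1: "(t ^ m + 1) * (1 - \<delta>) \<in> I"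
proof -
  have "(t ^ m + 1) * (1 - \<delta>) = (1 - \<delta>) * (t ^ m + t + t ^ 2) - \<delta> * (1 - \<delta>)"
    unfolding delta_eq by algebra
  then show ?thesis using I_diff I_mult I_t_power I_delta_idem by metis
qed

section \<open>The complement of the idempotent as an explicit lattice quotient\<close>

context
  fixes \<sigma> c a b r w N :: int
  assumes pow: "\<delta> dvd t ^ m + 1 - smult (\<sigma> * c) [:a, - b:]"
    and \<sigma>: "\<sigma> * \<sigma> = 1" and bezout: "a * w - b * r = 1"
    and N: "N = a ^ 2 + a * b - b ^ 2"
begin

text \<open>By \<open>bezout\<close>, \<open>a - b t\<close> and \<open>r - w t\<close> form a basis
  of the integer lattice of linear polynomials. The ideal generated by \<open>c (a - b t)\<close>
  modulo \<delta> then has the lattice basis \<open>c (a - b t)\<close>,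
  \<open>c N (r - w t)\<close>, and both elements are shown to vanish on the complement.\<close>

lemma I_generators:
  "smult c [:a, - b:] * (1 - \<delta>) \<in> I"
  "smult (c * N) [:r, - w:] * (1 - \<delta>) \<in> I"
proof -
  obtain q where q: "t ^ m + 1 - smult (\<sigma> * c) [:a, - b:] = \<delta> * q" using pow by (rule dvdE)
  have \<sigma>': "of_int \<sigma> * of_int \<sigma> = (1 :: int poly)" by (metis \<sigma> of_int_1 of_int_mult)
  have lin: "smult k [:x, y:] = of_int k * (of_int x + of_int y * t)" for k x y
    by (simp add: t_def of_int_poly)
  have "of_int c * (of_int a - of_int b * t) * (1 - \<delta>) =
      (of_int \<sigma> * of_int \<sigma>) * (of_int c * (of_int a - of_int b * t) * (1 - \<delta>))"
    by (simp add: \<sigma>')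
  also have "\<dots> = of_int \<sigma> * (of_int \<sigma> * of_int c * (of_int a - of_int b * t)) * (1 - \<delta>)"
    by (simp add: mult_ac)
  also have "of_int \<sigma> * of_int c * (of_int a - of_int b * t) = t ^ m + 1 - \<delta> * q"
    using q unfolding lin by (simp add: algebra_simps)
  also have "of_int \<sigma> * (t ^ m + 1 - \<delta> * q) * (1 - \<delta>) =
      of_int \<sigma> * ((t ^ m + 1) * (1 - \<delta>)) - of_int \<sigma> * q * (\<delta> * (1 - \<delta>))"
    by (simp add: algebra_simps)
  finally have "of_int c * (of_int a - of_int b * t) * (1 - \<delta>)
      = of_int \<sigma> * ((t ^ m + 1) * (1 - \<delta>)) - of_int \<sigma> * q * (\<delta> * (1 - \<delta>))" .
  then have 1: "of_int c * (of_int a - of_int b * t) * (1 - \<delta>) \<in> I"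
    using I_diff I_mult I_t_power_add_1 I_delta_idem by metis
  then show "smult c [:a, - b:] * (1 - \<delta>) \<in> I" unfolding lin by simp
  have bz: "of_int a * of_int w - of_int b * of_int r = (1 :: int poly)"
    by (metis bezout of_int_1 of_int_diff of_int_mult)
  have N': "(of_int N :: int poly) = of_int a ^ 2 + of_int a * of_int b - of_int b ^ 2"
    unfolding N by simp
  \<comment> \<open>Modulo \<delta>, \<open>t (a - b t) = -b + (a + b) t\<close>. Its coordinate
    along \<open>a - b t\<close> is minus \<open>?e\<close> and along \<open>r - w t\<close> it is
    \<open>-N\<close>, whence \<open>N (r - w t) = -(t + ?e) (a - b t)\<close>.\<close>
  let ?e = "of_int b * of_int w - (of_int a + of_int b) * of_int r :: int poly"
  have "of_int c * of_int N * (of_int r - of_int w * t) * (1 - \<delta>) =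
     - (t + ?e) * (of_int c * (of_int a - of_int b * t) * (1 - \<delta>)) - of_int c * of_int b * (\<delta> * (1 - \<delta>))"
    using bz unfolding N' delta_eq by algebra
  then have "of_int c * of_int N * (of_int r - of_int w * t) * (1 - \<delta>) \<in> I"
    using I_diff I_mult 1 I_delta_idem by metis
  then show "smult (c * N) [:r, - w:] * (1 - \<delta>) \<in> I" unfolding lin of_int_mult by simp
qed

text \<open>On the \<delta> component \<open>t\<close> acts as 1, so only \<open>p(1)\<close> modulo
  3 matters. On the complement only the remainder \<open>x + y t\<close> modulo \<delta> matters;
  the two linear forms are its coordinates along \<open>a - b t\<close> and
  \<open>-(r - w t)\<close>, and the divisibilities say that it lies in the lattice spanned by the
  two generators.\<close>

lemma I_iff:
  "p \<in> I \<longleftrightarrow> 3 dvd poly p 1 \<and> c dvd w * fst (fib_rem p) + r * snd (fib_rem p)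
     \<and> c * N dvd b * fst (fib_rem p) + a * snd (fib_rem p)" (is "_ \<longleftrightarrow> ?R")
proof
  define x y where "x = fst (fib_rem p)" and "y = snd (fib_rem p)"
  assume ?R
  then obtain k1 k2 k3 where k: "poly p 1 = 3 * k1" "w * x + r * y = c * k2" "b * x + a * y = c * N * k3"
    by (auto simp: x_def y_def dvd_def)
  obtain q where q: "p - [:x, y:] = \<delta> * q"
    using fib_poly_dvd_fib_rem[of p] unfolding x_def y_def \<delta>_def by (rule dvdE)
  have "poly (p - [:poly p 1:]) 1 = 0" by simp
  then have "[:-1, 1:] dvd p - [:poly p 1:]" by (simp only: poly_eq_0_iff_dvd)
  then obtain q' where q': "p - [:poly p 1:] = (t - 1) * q'" by (auto simp: t_def dvd_def one_pCons)
  \<comment> \<open>The inverse change of basis, recovering the remainder from its two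
    coordinates.\<close>
  have "x = (w * x + r * y) * a - (b * x + a * y) * r" "y = (b * x + a * y) * w - (w * x + r * y) * b"
    using bezout by algebra+
  then have "x = c * k2 * a - c * N * k3 * r" "y = c * N * k3 * w - c * k2 * b"
    unfolding k by auto
  then have "[:x, y:] = [:k2:] * smult c [:a, - b:] - [:k3:] * smult (c * N) [:r, - w:]"
    by (simp add: algebra_simps)
  moreover have "[:poly p 1:] = [:k1:] * 3" unfolding k by (simp add: numeral_poly)
  \<comment> \<open>Split \<open>p = p \<delta> + p (1 - \<delta>)\<close>, replacing
    \<open>p\<close> by its value at 1 in the first summand and by its linear remainder in the
    second.\<close>
  ultimately have "p = q' * ((t - 1) * \<delta>) + [:k1:] * (3 * \<delta>) + q * (\<delta> * (1 - \<delta>))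
     + [:k2:] * (smult c [:a, - b:] * (1 - \<delta>)) - [:k3:] * (smult (c * N) [:r, - w:] * (1 - \<delta>))"
    using q q' by algebra
  then show "p \<in> I"
    using I_add I_diff I_mult I_t_delta I_3_delta I_delta_idem I_generators by metis
next
  assume "p \<in> I"
  then obtain q s where p: "p = q * (monom 1 (2 * m) - 1) + s * relator m"
    by (auto simp: I_def relator_ideal_def)
  have "poly (relator m) 1 = 3" by (simp add: relator_def poly_monom)
  then have 3: "3 dvd poly p 1" by (simp add: p poly_monom)
  obtain e where e: "t ^ m + 1 - smult (\<sigma> * c) [:a, - b:] = \<delta> * e" using pow by (rule dvdE)
  \<comment> \<open>Modulo \<open>\<delta>\<close>, \<open>t\<close> has the inverse \<open>t + 1\<close>, so the ideal becomes the principal one generated by \<open>t ^ m + 1\<close>.\<close>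
  define g where "g = smult \<sigma> (q * (t ^ m - 1) + s * (t + 1))"
  \<comment> \<open>Here \<open>T\<close>, \<open>F\<close>, \<open>u\<close>, \<open>K\<close>
    stand for \<open>t^m\<close>, the relator, the sign and \<open>c (a - b t)\<close>. Modulo
    \<delta>, multiplying \<open>t F = T + t + t^2\<close> by \<open>t + 1\<close> gives
    \<open>F = (t + 1) (T + 1)\<close>, while \<open>T^2 - 1 = (T - 1) (T + 1)\<close>.\<close>
  have identity: "q * (T * T - 1) + s * F - u * (q * (T - 1) + s * (t + 1)) * K =
      \<delta> * (q * (T - 1) * e + s * (t + 1) * (1 + e) - s * F)"
    if "T + 1 - u * K = \<delta> * e" "t * F = T + t + t ^ 2" for T F u K
    using that unfolding delta_eq by algebra
  have "p - g * smult c [:a, - b:] = \<delta> * (q * (t ^ m - 1) * e + s * (t + 1) * (1 + e) - s * relator m)"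
  proof -
    have "t ^ m + 1 - of_int \<sigma> * smult c [:a, - b:] = \<delta> * e"
      using e by (simp add: of_int_poly mult_ac)
    from identity[OF this t_relator] show ?thesis
      by (simp add: p g_def monom_eq_t_power mult_2 power_add of_int_poly)
  qed
  then have "\<delta> dvd p - g * smult c [:a, - b:]" by (rule dvdI)
  moreover obtain x y where xy: "fib_rem g = (x, y)" by fastforce
  then have "\<delta> dvd g - [:x, y:]" using fib_poly_dvd_fib_rem[of g] by (simp add: \<delta>_def)
  then have "\<delta> dvd (g - [:x, y:]) * smult c [:a, - b:]" by (rule dvd_mult2)
  ultimately have "\<delta> dvd (p - g * smult c [:a, - b:]) + (g - [:x, y:]) * smult c [:a, - b:]"
    by (rule dvd_add)
  moreover have "(p - g * K) + (g - u) * K = p - u * K" for K u by (simp add: left_diff_distrib)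
  ultimately have "\<delta> dvd p - [:x, y:] * smult c [:a, - b:]" by metis
  then have "fib_rem p = fib_rem ([:x, y:] * smult c [:a, - b:])"
    unfolding \<delta>_def by (rule fib_rem_cong)
  then have rem: "fst (fib_rem p) = c * (x * a - y * b)" "snd (fib_rem p) = c * (y * a - x * b + y * b)"
    by (simp_all add: algebra_simps)
  have "b * fst (fib_rem p) + a * snd (fib_rem p) = c * N * y"
    unfolding rem N by algebra
  moreover have "w * fst (fib_rem p) + r * snd (fib_rem p) = c * (w * (x * a - y * b) + r * (y * a - x * b + y * b))"
    unfolding rem by algebra
  ultimately show ?R using 3 by simp
qed

end

end

text \<open>The expansion of \<open>t^m\<close> modulo \<open>fib_poly\<close> gives
  \<open>t^m + 1 = (-1)^m c (a - b t)\<close>, where \<open>c\<close> is the common factor taken out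
  of the two coefficients. The three divisibility conditions of \<open>I_iff\<close> then become the
  three cyclic factors.\<close>

theorem abelianization_cyc_presented_iso_fib:
  fixes m c k :: nat and a b N :: int
  defines "X \<equiv> {..<2 * m}"
  assumes m: "m \<ge> 1" "\<not> 3 dvd m"
    and a: "int c * a = (-1) ^ m + int (fib (m - 1))" and b: "int c * b = int (fib m)"
    and coprime: "coprime a b"
    and N: "N = a ^ 2 + a * b - b ^ 2" and k: "\<bar>N\<bar> = int k"
  shows "abelianization (cyc_presented_group (2 * m)
           (free_gen X 0 \<otimes>\<^bsub>free_group X\<^esub> free_gen X 1 \<otimes>\<^bsub>free_group X\<^esub> free_gen X (m - 1)))
         \<cong> integer_mod_group 3 \<times>\<times> integer_mod_group c \<times>\<times> integer_mod_group (c * k)"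
proof -
  obtain u v where "u * a + v * b = 1"
    using bezout_int[of a b] coprime by (auto simp: coprime_iff_gcd_eq_1)
  then obtain w r where bezout: "a * w - b * r = 1"
    by (metis add_uminus_conv_diff minus_minus mult.commute mult_minus_right)
  define \<sigma> :: int where "\<sigma> = (-1) ^ m"
  have \<sigma>: "\<sigma> * \<sigma> = 1" by (simp add: \<sigma>_def flip: power_mult_distrib)
  have pow: "fib_poly dvd [:0, 1:] ^ m + 1 - smult (\<sigma> * int c) [:a, - b:]"
  proof -
    obtain j where j: "m = Suc j" using m by (cases m) auto
    have "smult (\<sigma> * int c) [:a, - b:] = smult \<sigma> [:int c * a, - (int c * b):]"
      by simp
    also have "\<dots> = 1 + smult ((-1) ^ j) [:- int (fib j), int (fib m):]"
      unfolding a b by (simp add: \<sigma>_def j algebra_simps one_pCons flip: power_mult_distrib)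
    finally show ?thesis
      using fib_poly_dvd_monom[of j] by (simp add: j monom_altdef algebra_simps del: power_Suc)
  qed
  let ?d = "monom 1 (2 * m) - 1 :: int poly"
  let ?H = "integer_mod_group 3 \<times>\<times> integer_mod_group c \<times>\<times> integer_mod_group (c * k)"
  let ?w = "[(0, True), (1, True), (m - 1, True)]"
  define \<Lambda> where "\<Lambda> p = (poly p 1 mod int 3, (w * fst (fib_rem p) + r * snd (fib_rem p)) mod int c,
     (b * fst (fib_rem p) + a * snd (fib_rem p)) mod int (c * k))" for p
  have w: "?w \<in> gwords X" using m by (auto simp: X_def)
  have wp: "word_poly ?w = relator m"
    by (simp add: relator_def monom_Suc flip: one_pCons)
  have "abelianization (cyc_presented_group (2 * m) (free_class {..<2 * m} ?w)) \<cong> ?H"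
  proof (rule abelianization_cyc_presented_group_iso)
    show "Group.group ?H" by (intro DirProd_group group_integer_mod_group)
    show "\<Lambda> (p + q) = \<Lambda> p \<otimes>\<^bsub>?H\<^esub> \<Lambda> q" for p q
      by (simp add: \<Lambda>_def fib_rem_add mod_add_eq) (simp add: algebra_simps)
    show "range \<Lambda> = carrier ?H"
    proof
      show "range \<Lambda> \<subseteq> carrier ?H" unfolding \<Lambda>_def by (auto simp del: of_nat_mult of_nat_numeral)
      show "carrier ?H \<subseteq> range \<Lambda>"
      proof
        fix z assume "z \<in> carrier ?H"
        then obtain i j l where z: "z = (i, j, l)" "i mod int 3 = i" "j mod int c = j" "l mod int (c * k) = l"
          by (force simp: carrier_integer_mod_group split: if_splits)
        define x y where "x = j * a - l * r" and "y = l * w - j * b"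
        have "w * x + r * y = j" "b * x + a * y = l"
          unfolding x_def y_def using bezout by algebra+
        \<comment> \<open>As \<open>fib_poly\<close> takes the value 1 at 1, adding a constant
          multiple of it adjusts the value at 1 to \<open>i\<close> without changing the
          remainder.\<close>
        moreover have "fib_rem ([:x, y:] + fib_poly * [:i - x - y:]) = (x, y)"
          by (simp only: fib_rem_add fib_rem_mult_fib_poly) (simp add: plus_prod_def)
        ultimately have "\<Lambda> ([:x, y:] + fib_poly * [:i - x - y:]) = z"
          using z unfolding \<Lambda>_def by (simp add: fib_poly_def)
        then show "z \<in> range \<Lambda>" by (metis rangeI)
      qed
    qed
    show "\<Lambda> p = \<one>\<^bsub>?H\<^esub> \<longleftrightarrow> (\<exists>q s. p = q * ?d + s * word_poly ?w)" for p
    proof -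
      have "\<bar>int c * N\<bar> = int (c * k)" using k by (simp add: abs_mult)
      then have "int (c * k) dvd x \<longleftrightarrow> int c * N dvd x" for x by (metis abs_dvd_iff)
      then have "\<Lambda> p = \<one>\<^bsub>?H\<^esub> \<longleftrightarrow> 3 dvd poly p 1 \<and> int c dvd w * fst (fib_rem p) + r * snd (fib_rem p)
        \<and> int c * N dvd b * fst (fib_rem p) + a * snd (fib_rem p)"
        by (simp add: \<Lambda>_def mod_eq_0_iff_dvd)
      also have "\<dots> \<longleftrightarrow> p \<in> relator_ideal m"
        by (rule I_iff[OF m pow \<sigma> bezout N, symmetric])
      finally show ?thesis unfolding wp by (simp add: relator_ideal_def)
    qed
  qed (use m w in \<open>auto simp: X_def\<close>)
  also have "free_class {..<2 * m} ?w =
     free_gen X 0 \<otimes>\<^bsub>free_group X\<^esub> free_gen X 1 \<otimes>\<^bsub>free_group X\<^esub> free_gen X (m - 1)"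
    using w by (simp add: free_gen_def mult_free_class X_def)
  finally show ?thesis .
qed

section \<open>Fibonacci and Lucas numbers\<close>

lemma lucas_Suc: "lucas (Suc j) = fib j + fib (Suc (Suc j))"
  by (induction j rule: fib.induct) auto

lemma lucas_pos: "lucas k > 0"
  by (induction k rule: lucas.induct) auto

text \<open>Four steps of the recursion multiply by 2 modulo 3, so divisibility has period 4. It
  decides when the factor of order 3 can be merged by the Chinese remainder theorem.\<close>

lemma three_dvd_lucas_iff: "3 dvd lucas k \<longleftrightarrow> k mod 4 = 2"
proof (induction k rule: less_induct)
  case (less k)
  show ?case
  proof (cases "k < 4")
    case True
    then have "k \<in> {0, 1, 2, 3}" by auto
    moreover have "lucas 2 = 3" "lucas 3 = 4" by (simp_all add: numeral_eq_Suc)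
    ultimately show ?thesis by auto
  next
    case False
    then obtain j where k: "k = j + 4" by (metis add.commute le_Suc_ex not_less)
    then have "lucas k = 3 * lucas (Suc j) + 2 * lucas j" by (simp add: numeral_eq_Suc)
    then have "3 dvd lucas k \<longleftrightarrow> 3 dvd lucas j" by presburger
    then show ?thesis using less[of j] k by simp
  qed
qed

lemma three_dvd_fib_iff: "3 dvd fib k \<longleftrightarrow> k mod 4 = 0"
proof (induction k rule: less_induct)
  case (less k)
  show ?case
  proof (cases "k < 4")
    case True
    then have "k \<in> {0, 1, 2, 3}" by auto
    moreover have "fib 2 = 1" "fib 3 = 2" by (simp_all add: numeral_eq_Suc)
    ultimately show ?thesis by auto
  next
    case False
    then obtain j where k: "k = j + 4" by (metis add.commute le_Suc_ex not_less)
    then have "fib k = 3 * fib (Suc j) + 2 * fib j" by (simp add: numeral_eq_Suc)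
    then have "3 dvd fib k \<longleftrightarrow> 3 dvd fib j" by presburger
    then show ?thesis using less[of j] k by simp
  qed
qed

lemma two_dvd_fib_iff: "2 dvd fib k \<longleftrightarrow> k mod 3 = 0"
proof (induction k rule: less_induct)
  case (less k)
  show ?case
  proof (cases "k < 3")
    case True
    then have "k \<in> {0, 1, 2}" by auto
    moreover have "fib 2 = 1" by (simp_all add: numeral_eq_Suc)
    ultimately show ?thesis by auto
  next
    case False
    then obtain j where k: "k = j + 3" by (metis add.commute le_Suc_ex not_less)
    then have "fib k = 2 * fib (Suc j) + fib j" by (simp add: numeral_eq_Suc)
    then have "2 dvd fib k \<longleftrightarrow> 2 dvd fib j" by presburger
    then show ?thesis using less[of j] k by simp
  qed
qed

lemma integer_mod_group_one_DirProd:
  "integer_mod_group 1 \<times>\<times> integer_mod_group n \<cong> integer_mod_group n"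
proof (rule is_isoI, rule isoI)
  have eq: "carrier (integer_mod_group 1 \<times>\<times> integer_mod_group n) = {0} \<times> carrier (integer_mod_group n)"
    by (auto simp: carrier_integer_mod_group)
  show "snd \<in> hom (integer_mod_group 1 \<times>\<times> integer_mod_group n) (integer_mod_group n)"
    by (auto simp: hom_def)
  show "bij_betw snd (carrier (integer_mod_group 1 \<times>\<times> integer_mod_group n)) (carrier (integer_mod_group n))"
    unfolding eq by (auto simp: bij_betw_def inj_on_def image_iff)
qed

lemma DirProd_left_commute_iso: "G \<times>\<times> H \<times>\<times> K \<cong> H \<times>\<times> G \<times>\<times> K"
  by (rule is_isoI[where h = "\<lambda>(x, y, z). (y, x, z)"])
    (auto simp: iso_def hom_def inj_on_def bij_betw_def image_iff)

text \<open>When the norm is 5 or 1 this forces \<open>a\<close> and \<open>b\<close> to be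
  coprime.\<close>

lemma gcd_square_dvd_norm: "(gcd a b) ^ 2 dvd a ^ 2 + a * b - b ^ 2" for a b :: int
proof -
  have "gcd a b ^ 2 dvd a ^ 2" "gcd a b * gcd a b dvd a * b" "gcd a b ^ 2 dvd b ^ 2"
    by (simp_all add: dvd_power_same mult_dvd_mono)
  then show ?thesis by (simp add: power2_eq_square)
qed

text \<open>The left side is the norm of \<open>F_(k-1) - F_k t\<close>, which is
  \<open>(-1)^k t^k\<close> modulo \<open>fib_poly\<close>; the norm of the unit \<open>t\<close> is
  -1.\<close>

lemma fib_Cassini_pred:
  assumes "k \<ge> 1"
  shows "int (fib (k - 1)) ^ 2 + int (fib (k - 1)) * int (fib k) - int (fib k) ^ 2 = (-1) ^ k"
proof -
  obtain j where "k = Suc j" using assms by (cases k) auto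
  then show ?thesis using fib_Cassini_int[of j] by (simp add: algebra_simps power2_eq_square)
qed

lemma lucas_eq_fib: "k \<ge> 1 \<Longrightarrow> int (lucas k) = 2 * int (fib (k - 1)) + int (fib k)"
  by (cases k) (simp_all add: lucas_Suc)

lemma fib_double:
  assumes "k \<ge> 1"
  shows "int (fib (2 * k)) = int (fib k) * int (lucas k)"
    and "int (fib (2 * k - 1)) = int (fib (k - 1)) ^ 2 + int (fib k) ^ 2"
proof -
  show "int (fib (2 * k)) = int (fib k) * int (lucas k)"
    unfolding fib_rec_even' using lucas_eq_fib[OF assms] by simp
  obtain j where "k = Suc j" using assms by (cases k) auto
  then show "int (fib (2 * k - 1)) = int (fib (k - 1)) ^ 2 + int (fib k) ^ 2"
    using fib_rec_odd[of j] by simp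
qed

section \<open>The four cases\<close>

definition "Gab m =
  abelianization (cyc_presented_group (2 * m)
     (free_gen {..<2 * m} 0 \<otimes>\<^bsub>free_group {..<2 * m}\<^esub> free_gen {..<2 * m} 1
       \<otimes>\<^bsub>free_group {..<2 * m}\<^esub> free_gen {..<2 * m} (m - 1)))"

text \<open>Here \<open>c = 1\<close>. Cassini's identity shows that \<open>gcd a b\<close> divides
  2, and \<open>F_m\<close> is odd because 3 does not divide \<open>m\<close>. The norm is
  \<open>-L_m\<close>, which is prime to 3 for odd \<open>m\<close>.\<close>

lemma Gab_odd:
  assumes "odd m" "\<not> 3 dvd m"
  shows "Gab m \<cong> integer_mod_group (3 * lucas m)"
proof -
  define a b where "a = int (fib (m - 1)) - 1" and "b = int (fib m)"
  have m: "m \<ge> 1" using assms by (cases m) auto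
  have cassini: "(a + 1) ^ 2 + (a + 1) * b - b ^ 2 = - 1"
    using fib_Cassini_pred[OF m] assms by (simp add: a_def b_def)
  have "2 = - (a * (a + 2 + b) + b * (1 - b))"
    using cassini by algebra
  then have "gcd a b dvd 2" by (metis dvd_add dvd_minus_iff dvd_mult2 gcd_dvd1 gcd_dvd2)
  moreover have "\<not> 2 dvd gcd a b"
    using two_dvd_fib_iff[of m] assms by (auto simp: b_def mod_eq_0_iff_dvd)
  moreover have "g = 1" if "g dvd 2" "\<not> 2 dvd g" "g \<ge> 0" for g :: int
  proof -
    have "g \<le> 2" using that(1) by (rule zdvd_imp_le) simp
    with that have "g = 0 \<or> g = 1 \<or> g = 2" by linarith
    with that show ?thesis by auto
  qed
  ultimately have "gcd a b = 1" by simp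
  then have coprime: "coprime a b" by (simp add: coprime_iff_gcd_eq_1)
  have N: "- int (lucas m) = a ^ 2 + a * b - b ^ 2"
    using cassini lucas_eq_fib[OF m] unfolding a_def b_def by algebra
  have "Gab m \<cong> integer_mod_group 3 \<times>\<times> integer_mod_group 1 \<times>\<times> integer_mod_group (1 * lucas m)"
    unfolding Gab_def
    by (rule abelianization_cyc_presented_iso_fib[OF m assms(2) _ _ coprime N])
      (use assms in \<open>auto simp: a_def b_def\<close>)
  also have "\<dots> \<cong> integer_mod_group 3 \<times>\<times> integer_mod_group (lucas m)"
    using group.DirProd_iso_trans[OF group_integer_mod_group iso_refl integer_mod_group_one_DirProd] by simp
  also have "\<dots> \<cong> integer_mod_group (3 * lucas m)"
  proof (rule group.iso_sym[OF group_integer_mod_group integer_mod_group_crt])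
    have "\<not> 3 dvd lucas m" using assms(1) by (subst three_dvd_lucas_iff) presburger
    then show "coprime 3 (lucas m)" by (simp add: prime_imp_coprime)
  qed (simp_all add: lucas_pos)
  finally (iso_trans) show ?thesis .
qed

text \<open>For odd \<open>k\<close>, Cassini's identity makes \<open>1 + F_(2k-1)\<close> divisible
  by \<open>F_k\<close>, as is \<open>F_(2k) = F_k L_k\<close>. So \<open>c = F_k\<close>, and the
  cofactors \<open>a\<close> and \<open>b = L_k\<close> have norm 5.\<close>

lemma Gab_double_odd:
  assumes "odd k" "\<not> 3 dvd k"
  shows "Gab (2 * k) \<cong> integer_mod_group (fib k) \<times>\<times> integer_mod_group (15 * fib k)"
proof -
  define x y where "x = int (fib (k - 1))" and "y = int (fib k)"
  define a b where "a = 2 * y - x" and "b = 2 * x + y"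
  have k: "k \<ge> 1" using assms by (cases k) auto
  then have m: "2 * k \<ge> 1" "\<not> 3 dvd 2 * k" using assms by (auto simp: prime_dvd_mult_iff)
  have cassini: "x ^ 2 + x * y - y ^ 2 = - 1"
    using fib_Cassini_pred[OF k] assms by (simp add: x_def y_def)
  have N: "5 = a ^ 2 + a * b - b ^ 2"
    using cassini unfolding a_def b_def by algebra
  have "gcd a b ^ 2 dvd 5" using gcd_square_dvd_norm[of a b] N by simp
  moreover have "g = 1" if "g ^ 2 dvd 5" "g \<ge> 0" for g :: int
  proof -
    have "g * g \<le> 5" using zdvd_imp_le[OF that(1)] by (simp add: power2_eq_square)
    then have "g < 3" using mult_mono[of 3 g 3 g] by linarith
    with that have "g = 0 \<or> g = 1 \<or> g = 2" by linarith
    with that show ?thesis by auto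
  qed
  ultimately have "gcd a b = 1" by simp
  then have coprime: "coprime a b" by (simp add: coprime_iff_gcd_eq_1)
  have "int (fib k) * a = 1 + int (fib (2 * k - 1))"
    unfolding fib_double(2)[OF k] using cassini unfolding a_def x_def y_def by algebra
  moreover have "int (fib k) * b = int (fib (2 * k))"
    unfolding fib_double(1)[OF k] lucas_eq_fib[OF k] by (simp add: b_def x_def y_def)
  ultimately have "Gab (2 * k) \<cong> integer_mod_group 3 \<times>\<times> integer_mod_group (fib k) \<times>\<times> integer_mod_group (fib k * 5)"
    unfolding Gab_def
    by (intro abelianization_cyc_presented_iso_fib[OF m _ _ coprime N]) simp_all
  also have "\<dots> \<cong> integer_mod_group (fib k) \<times>\<times> integer_mod_group 3 \<times>\<times> integer_mod_group (fib k * 5)"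
    by (rule DirProd_left_commute_iso)
  also have "\<dots> \<cong> integer_mod_group (fib k) \<times>\<times> integer_mod_group (3 * (fib k * 5))"
  proof (rule group.DirProd_iso_trans[OF group_integer_mod_group iso_refl
        group.iso_sym[OF group_integer_mod_group integer_mod_group_crt]])
    have "\<not> 3 dvd fib k" using assms(1) by (subst three_dvd_fib_iff) presburger
    then show "coprime 3 (fib k * 5)" by (simp add: prime_imp_coprime)
  qed (use k in \<open>simp_all add: fib_neq_0_nat\<close>)
  finally (iso_trans) show ?thesis by (simp add: mult.commute)
qed

text \<open>For even \<open>k\<close> the sign in Cassini's identity changes and the common factor
  becomes \<open>c = L_k\<close>, with cofactors \<open>F_(k-1)\<close> and \<open>F_k\<close> of
  norm 1.\<close>

lemma Gab_double_even:
  assumes "even k" "k \<ge> 1" "\<not> 3 dvd k"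
  shows "Gab (2 * k) \<cong> integer_mod_group 3 \<times>\<times> integer_mod_group (lucas k) \<times>\<times> integer_mod_group (lucas k)"
proof -
  define a b where "a = int (fib (k - 1))" and "b = int (fib k)"
  have m: "2 * k \<ge> 1" "\<not> 3 dvd 2 * k" using assms by (auto simp: prime_dvd_mult_iff)
  have N: "1 = a ^ 2 + a * b - b ^ 2"
    using fib_Cassini_pred[OF assms(2)] assms by (simp add: a_def b_def)
  have "gcd a b ^ 2 dvd 1" using gcd_square_dvd_norm[of a b] N by simp
  then have "is_unit (gcd a b) \<or> (2 :: nat) = 0" by (simp only: is_unit_power_iff)
  then have coprime: "coprime a b" by (simp add: coprime_iff_gcd_eq_1)
  have "int (lucas k) * a = 1 + int (fib (2 * k - 1))"
    unfolding fib_double(2)[OF assms(2)] lucas_eq_fib[OF assms(2)]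
    using N unfolding a_def b_def by algebra
  moreover have "int (lucas k) * b = int (fib (2 * k))"
    unfolding fib_double(1)[OF assms(2)] by (simp add: b_def)
  ultimately have "Gab (2 * k) \<cong> integer_mod_group 3 \<times>\<times> integer_mod_group (lucas k) \<times>\<times> integer_mod_group (lucas k * 1)"
    unfolding Gab_def
    by (intro abelianization_cyc_presented_iso_fib[OF m _ _ coprime N]) simp_all
  then show ?thesis by simp
qed

lemma Gab_double_four_dvd:
  assumes "4 dvd k" "k \<ge> 1" "\<not> 3 dvd k"
  shows "Gab (2 * k) \<cong> integer_mod_group (lucas k) \<times>\<times> integer_mod_group (3 * lucas k)"
proof -
  have "even k" using assms(1) by presburger
  then have "Gab (2 * k) \<cong> integer_mod_group 3 \<times>\<times> integer_mod_group (lucas k) \<times>\<times> integer_mod_group (lucas k)"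
    using assms by (intro Gab_double_even)
  also have "\<dots> \<cong> integer_mod_group (lucas k) \<times>\<times> integer_mod_group 3 \<times>\<times> integer_mod_group (lucas k)"
    by (rule DirProd_left_commute_iso)
  also have "\<dots> \<cong> integer_mod_group (lucas k) \<times>\<times> integer_mod_group (3 * lucas k)"
  proof (rule group.DirProd_iso_trans[OF group_integer_mod_group iso_refl
        group.iso_sym[OF group_integer_mod_group integer_mod_group_crt]])
    have "\<not> 3 dvd lucas k" using assms(1) by (subst three_dvd_lucas_iff) presburger
    then show "coprime 3 (lucas k)" by (simp add: prime_imp_coprime)
  qed (simp_all add: lucas_pos)
  finally (iso_trans) show ?thesis .
qed

theorem theorem4p10:
  fixes n :: nat
  defines "F \<equiv> free_group {..<n}"
  defines "x \<equiv> free_gen {..<n}"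
  defines "G \<equiv> cyc_presented_group n (x 0 \<otimes>\<^bsub>F\<^esub> x 1 \<otimes>\<^bsub>F\<^esub> x (n div 2 - 1))"
  assumes "n \<ge> 1" and "gcd n 6 = 2"
  shows "(gcd n 16 = 2 \<longrightarrow>
            abelianization G \<cong> integer_mod_group (3 * lucas (n div 2))) \<and>
         (gcd n 16 = 4 \<longrightarrow>
            abelianization G \<cong>
              integer_mod_group (fib (n div 4)) \<times>\<times> integer_mod_group (15 * fib (n div 4))) \<and>
         (gcd n 16 = 8 \<longrightarrow>
            abelianization G \<cong>
              integer_mod_group 3 \<times>\<times> integer_mod_group (lucas (n div 4)) \<times>\<times>
                integer_mod_group (lucas (n div 4))) \<and>
         (gcd n 16 = 16 \<longrightarrow>
            abelianization G \<cong>
              integer_mod_group (lucas (n div 4)) \<times>\<times> integer_mod_group (3 * lucas (n div 4)))"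
proof -
  define m where "m = n div 2"
  have "even n" using assms(5) by (metis gcd_dvd1)
  then have n: "n = 2 * m" by (simp add: m_def)
  have "\<not> 3 dvd n"
  proof
    assume "3 dvd n"
    then have "3 dvd gcd n 6" by (intro gcd_greatest) auto
    then show False using assms(5) by simp
  qed
  then have m3: "\<not> 3 dvd m" using n by (metis dvd_mult)
  have G: "abelianization G = Gab m"
    unfolding Gab_def G_def F_def x_def m_def[symmetric] by (simp add: n)
  \<comment> \<open>The four values of \<open>gcd n 16\<close> translate into the parity of
    \<open>m\<close> and the divisibility of \<open>n div 4\<close> by 2 and 4.\<close>
  have d4: "4 dvd n \<longleftrightarrow> 4 dvd gcd n 16" and d8: "8 dvd n \<longleftrightarrow> 8 dvd gcd n 16"
    by simp_all
  show ?thesis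
  proof (intro conjI impI)
    assume "gcd n 16 = 2"
    then have "odd m" using d4 n by simp
    then show "abelianization G \<cong> integer_mod_group (3 * lucas (n div 2))"
      unfolding G m_def[symmetric] using m3 by (rule Gab_odd)
  next
    assume "gcd n 16 = 4"
    then have "4 dvd n" "\<not> 8 dvd n" using d4 d8 by simp_all
    then have k: "m = 2 * (n div 4)" "odd (n div 4)" using n by presburger+
    then have "\<not> 3 dvd n div 4" using m3 by (metis dvd_mult)
    from Gab_double_odd[OF k(2) this]
    show "abelianization G \<cong> integer_mod_group (fib (n div 4)) \<times>\<times> integer_mod_group (15 * fib (n div 4))"
      unfolding G k(1)[symmetric] .
  next
    assume "gcd n 16 = 8"
    then have "8 dvd n" by (metis gcd_dvd1)
    then obtain j where "n = 8 * j" by (rule dvdE)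
    then have k: "m = 2 * (n div 4)" "even (n div 4)" "n div 4 \<ge> 1" using n assms(4) by auto
    then have "\<not> 3 dvd n div 4" using m3 by (metis dvd_mult)
    from Gab_double_even[OF k(2,3) this]
    show "abelianization G \<cong> integer_mod_group 3 \<times>\<times> integer_mod_group (lucas (n div 4)) \<times>\<times>
                integer_mod_group (lucas (n div 4))"
      unfolding G k(1)[symmetric] .
  next
    assume "gcd n 16 = 16"
    then have "16 dvd n" by (metis gcd_dvd1)
    then obtain j where "n = 16 * j" by (rule dvdE)
    then have j: "n div 4 = 4 * j" "m = 2 * (4 * j)" "j \<ge> 1" using n assms(4) by auto
    then have k: "m = 2 * (n div 4)" "4 dvd n div 4" "n div 4 \<ge> 1" by simp_all
    then have "\<not> 3 dvd n div 4" using m3 by (metis dvd_mult)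
    from Gab_double_four_dvd[OF k(2,3) this]
    show "abelianization G \<cong> integer_mod_group (lucas (n div 4)) \<times>\<times> integer_mod_group (3 * lucas (n div 4))"
      unfolding G k(1)[symmetric] .
  qed
qed

end
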